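(* Let $\mathcal{A}_1,\dots,\mathcal{A}_d\in\mathbb{R}^{n_1\times n_2\times n_3}$ be linearly independent and let $\mathbf{b}\in\mathbb{R}^d$ be such that $\{\mathcal{T}\in\mathbb{R}^{n_1\times n_2\times n_3}:\langle\mathcal{A}_\ell,\mathcal{T}\rangle=b_\ell,\ \ell=1,\dots,d\}\ne\emptyset$. Let $\Upsilon=\{\mathbf{x}_1,\dots,\mathbf{x}_m\}\subseteq\mathbb{B}^{n_1}$ and let $\widehat{\mathcal{Z}}_\Upsilon$ be (the $\mathcal{Z}$-component of) an optimal solution of DUAL(D) formed with $\Upsilon$. Let $\mathbf{x}^*$ be an optimal solution of $$\max_{\|\mathbf{x}\|=1}\ \big\|\widehat{\mathcal{Z}}_\Upsilon(\mathbf{x})\big\|_\sigma .$$ If $\mathbf{x}^*\in\Upsilon$, then $\widehat{\mathcal{Z}}_\Upsilon$ is also an optimal solution of DUAL.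
   Context: $\mathbb{B}^{n}=\{\mathbf{x}\in\mathbb{R}^n:\|\mathbf{x}\|=1\}$; $\langle\cdot,\cdot\rangle$ is the entrywise (Frobenius) inner product. For $\mathcal{Z}\in\mathbb{R}^{n_1\times n_2\times n_3}$ with first-mode slices $\mathbf{Z}_j\in\mathbb{R}^{n_2\times n_3}$, $\mathcal{Z}(\mathbf{x})=\sum_{j=1}^{n_1}x_j\mathbf{Z}_j$. For a matrix, $\|\cdot\|_\sigma$ is the spectral norm (largest singular value). DUAL: maximize $\boldsymbol\lambda^\top\mathbf{b}$ over $\boldsymbol\lambda\in\mathbb{R}^d$, $\mathcal{Z}\in\mathbb{R}^{n_1\times n_2\times n_3}$ subject to $$\begin{bmatrix}\mathbf{I}_{n_2}&\mathcal{Z}(\mathbf{x})\\ \mathcal{Z}(\mathbf{x})^\top&\mathbf{I}_{n_3}\end{bmatrix}\succeq0\ \ \forall\mathbf{x}\in\mathbb{B}^{n_1},\qquad \mathcal{Z}=\sum_{\ell=1}^d\lambda_\ell\mathcal{A}_\ell.$$ DUAL(D): the same as DUAL except that the semidefinite constraint is imposed only for $\mathbf{x}\in\Upsilon$. Since the $\mathcal{A}_\ell$ are linearly independent, $\boldsymbol\lambda$ is determined by $\mathcal{Z}$; saying that $\mathcal{Z}$ is an optimal solution means that the pair $(\boldsymbol\lambda,\mathcal{Z})$ is. *)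

theory Defs
  imports "HOL-Analysis.Analysis"
begin

text \<open>A tensor in $R^{n_1 \times n_2 \times n_3}$ is the iterated vector type below, so that
  \<open>Z $ j\<close> is the \<open>j\<close>-th first-mode slice (an $n_2 \times n_3$ matrix) and the library's
  inner product \<open>\<bullet>\<close> on this type is the entrywise (Frobenius) one.\<close>

type_synonym ('n1, 'n2, 'n3) tensor = "real ^ 'n3 ^ 'n2 ^ 'n1"

definition tensor_apply ::
  "('n1::finite, 'n2::finite, 'n3::finite) tensor \<Rightarrow> real ^ 'n1 \<Rightarrow> real ^ 'n3 ^ 'n2"
  where "tensor_apply Z x = (\<Sum>j\<in>UNIV. (x $ j) *\<^sub>R (Z $ j))"

text \<open>Singular values are the square roots of the eigenvalues of $M^T M$. For a matrix with more
  columns than rows this set may also contain a padding 0, which does not affect the maximum.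
  The set is finite and nonempty, so \<open>Max\<close> is meaningful.\<close>

definition singular_values :: "real ^ 'n ^ 'm \<Rightarrow> real set"
  where "singular_values M =
    {s. 0 \<le> s \<and> (\<exists>v. v \<noteq> 0 \<and> (transpose M ** M) *v v = s\<^sup>2 *\<^sub>R v)}"

definition spectral_norm :: "real ^ 'n ^ 'm \<Rightarrow> real"
  where "spectral_norm M = Max (singular_values M)"

definition pos_semidef :: "real ^ 'n ^ 'n \<Rightarrow> bool"
  where "pos_semidef M \<longleftrightarrow> transpose M = M \<and> (\<forall>v. 0 \<le> v \<bullet> (M *v v))"

definition block_matrix ::
  "real ^ 'a ^ 'a \<Rightarrow> real ^ 'b ^ 'a \<Rightarrow> real ^ 'a ^ 'b \<Rightarrow> real ^ 'b ^ 'b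
    \<Rightarrow> real ^ ('a + 'b) ^ ('a + 'b)"
  where "block_matrix P Q R S = (\<chi> i j.
    case i of
      Inl a \<Rightarrow> (case j of Inl a' \<Rightarrow> P $ a $ a' | Inr b' \<Rightarrow> Q $ a $ b')
    | Inr b \<Rightarrow> (case j of Inl a' \<Rightarrow> R $ b $ a' | Inr b' \<Rightarrow> S $ b $ b'))"

text \<open>The set \<open>X\<close> collects the points at which the semidefinite constraint is imposed: DUAL is
  the case of the whole unit sphere, DUAL(D) the case of a finite subset of it.\<close>

definition dual_feasible ::
  "('d::finite \<Rightarrow> ('n1::finite, 'n2::finite, 'n3::finite) tensor) \<Rightarrow> (real ^ 'n1) set
    \<Rightarrow> (real ^ 'd) \<times> ('n1, 'n2, 'n3) tensor \<Rightarrow> bool"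
  where "dual_feasible A X = (\<lambda>(lam, Z).
    (\<forall>x\<in>X. pos_semidef
        (block_matrix (mat 1) (tensor_apply Z x) (transpose (tensor_apply Z x)) (mat 1))) \<and>
    Z = (\<Sum>l\<in>UNIV. (lam $ l) *\<^sub>R A l))"

definition dual_optimal ::
  "('d::finite \<Rightarrow> ('n1::finite, 'n2::finite, 'n3::finite) tensor) \<Rightarrow> real ^ 'd
    \<Rightarrow> (real ^ 'n1) set \<Rightarrow> (real ^ 'd) \<times> ('n1, 'n2, 'n3) tensor \<Rightarrow> bool"
  where "dual_optimal A b X = is_arg_max (\<lambda>(lam, Z). lam \<bullet> b) (dual_feasible A X)"

end

theory Submission
  imports Defs
begin

text \<open>Both the block constraint at \<open>x\<close> and the inequality \<open>spectral_norm (tensor_apply Z x) \<le> 1\<close>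
  say that \<open>tensor_apply Z x\<close> is a contraction. Hence the constraint at a maximiser of the
  spectral norm implies the constraint on the whole sphere: an optimal solution of the relaxation
  DUAL(D) is feasible for DUAL, and therefore optimal for it.\<close>

lemma inner_matrix_transpose:
  fixes M :: "real ^ 'n ^ 'm"
  shows "(M *v x) \<bullet> y = x \<bullet> (transpose M *v y)"
  by (metis dot_lmul_matrix inner_commute vector_transpose_matrix transpose_transpose)

lemma inner_gram_matrix:
  fixes M :: "real ^ 'n ^ 'm"
  shows "((transpose M ** M) *v x) \<bullet> y = (M *v x) \<bullet> (M *v y)"
proof -
  have "((transpose M ** M) *v x) \<bullet> y = y \<bullet> (transpose M *v (M *v x))"
    by (simp only: matrix_vector_mul_assoc inner_commute)
  also have "\<dots> = (M *v x) \<bullet> (M *v y)"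
    by (simp only: inner_matrix_transpose[symmetric] inner_commute)
  finally show ?thesis .
qed

text \<open>Eigenvectors of \<open>M\<^sup>T M\<close> to distinct eigenvalues are orthogonal, hence independent.\<close>

lemma finite_singular_values:
  fixes M :: "real ^ 'n ^ 'm"
  shows "finite (singular_values M)"
proof -
  define S where "S = singular_values M"
  have "\<forall>s\<in>S. \<exists>v. v \<noteq> 0 \<and> (transpose M ** M) *v v = s\<^sup>2 *\<^sub>R v"
    by (auto simp: S_def singular_values_def)
  then obtain e where e0: "\<And>s. s \<in> S \<Longrightarrow> e s \<noteq> 0"
    and e: "\<And>s. s \<in> S \<Longrightarrow> (transpose M ** M) *v e s = s\<^sup>2 *\<^sub>R e s"
    by metis
  have orth: "e s \<bullet> e t = 0" if "s \<in> S" "t \<in> S" "s \<noteq> t" for s t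
  proof -
    have "s\<^sup>2 * (e s \<bullet> e t) = t\<^sup>2 * (e s \<bullet> e t)"
      using inner_gram_matrix[of M "e s" "e t"] inner_gram_matrix[of M "e t" "e s"] e that
      by (simp add: inner_commute)
    moreover have "s\<^sup>2 \<noteq> t\<^sup>2"
      using that by (auto simp: S_def singular_values_def)
    ultimately show ?thesis by simp
  qed
  have "inj_on e S"
    using orth e0 by (metis inj_onI inner_eq_zero_iff)
  moreover have "pairwise orthogonal (e ` S)"
    using orth by (auto simp: pairwise_def orthogonal_def)
  then have "finite (e ` S)"
    using e0 by (intro independent_imp_finite pairwise_orthogonal_independent) auto
  ultimately show ?thesis
    unfolding S_def by (metis finite_imageD)
qed

text \<open>With y = M^T u, the square of norm y is the inner product of M y and u, at most s * norm
  y * norm u by Cauchy-Schwarz; then cancel norm y.\<close>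

lemma norm_transpose_matrix_mult_le:
  fixes M :: "real ^ 'n ^ 'm"
  assumes "\<And>w. norm (M *v w) \<le> s * norm w"
  shows "norm (transpose M *v u) \<le> s * norm u"
proof (cases "transpose M *v u = 0")
  case True
  \<comment> \<open>Any unit vector in the hypothesis forces this; the choice of index is
    immaterial.\<close>
  have "0 \<le> s"
    using order_trans[OF norm_ge_zero assms[of "axis undefined 1"]] by (simp add: norm_axis_1)
  with True show ?thesis by simp
next
  case False
  let ?y = "transpose M *v u"
  have "norm ?y * norm ?y = (M *v ?y) \<bullet> u"
    by (metis inner_matrix_transpose power2_eq_square power2_norm_eq_inner)
  also have "\<dots> \<le> norm (M *v ?y) * norm u"
    by (rule norm_cauchy_schwarz)
  also have "\<dots> \<le> s * norm ?y * norm u"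
    by (rule mult_right_mono[OF assms]) simp
  finally show ?thesis
    using False by (simp add: mult.commute mult.left_commute)
qed

text \<open>By compactness the operator norm s is attained at a unit vector v, and such a maximiser
  is an eigenvector of M^T M for s^2. This links the eigenvalue definition of singular values to
  norm bounds and shows that there is one.\<close>

lemma singular_value_norm_bound:
  fixes M :: "real ^ 'n ^ 'm"
  obtains s where "s \<in> singular_values M" "\<And>w. norm (M *v w) \<le> s * norm w"
proof -
  have "axis undefined 1 \<in> sphere (0 :: real ^ 'n) 1"
    by (simp add: norm_axis_1)
  then have "sphere (0 :: real ^ 'n) 1 \<noteq> {}" by blast
  moreover have "continuous_on (sphere 0 1) (\<lambda>v. norm (M *v v))"
    by (intro continuous_intros)
  ultimately obtain v where v: "norm v = 1"
    and vmax: "\<And>w. norm w = 1 \<Longrightarrow> norm (M *v w) \<le> norm (M *v v)"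
    using continuous_attains_sup[of "sphere (0 :: real ^ 'n) 1" "\<lambda>v. norm (M *v v)"] by auto
  define s where "s = norm (M *v v)"
  have bound: "norm (M *v w) \<le> s * norm w" for w
  proof (cases "w = 0")
    case False
    then have "norm (M *v (inverse (norm w) *\<^sub>R w)) \<le> s"
      unfolding s_def by (intro vmax) simp
    with False show ?thesis
      by (simp add: matrix_vector_mult_scaleR field_simps)
  qed simp
  \<comment> \<open>Equality case of Cauchy-Schwarz: \<open>?g\<close> has norm at most s^2, yet its
    inner product with the unit vector v equals s^2. Expanding the square of
    \<open>?g - s\<^sup>2 *\<^sub>R v\<close> gives at most s^4 - 2 s^4 + s^4 = 0.\<close>
  let ?g = "transpose M *v (M *v v)"
  have "norm ?g \<le> s * s"
    using norm_transpose_matrix_mult_le[OF bound, of "M *v v"] by (simp add: s_def)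
  then have "(norm ?g)\<^sup>2 \<le> (s * s)\<^sup>2"
    by (intro power_mono) auto
  moreover have "?g \<bullet> v = s\<^sup>2"
    using inner_gram_matrix[of M v v]
    by (simp add: s_def power2_norm_eq_inner matrix_vector_mul_assoc del: transpose_matrix_vector)
  moreover have "(norm (?g - s\<^sup>2 *\<^sub>R v))\<^sup>2
      = (norm ?g)\<^sup>2 - 2 * s\<^sup>2 * (?g \<bullet> v) + (s\<^sup>2)\<^sup>2 * (norm v)\<^sup>2"
    unfolding power2_norm_eq_inner
    by (simp add: inner_diff inner_commute[of v ?g] power2_eq_square algebra_simps del: transpose_matrix_vector)
  ultimately have "(norm (?g - s\<^sup>2 *\<^sub>R v))\<^sup>2 \<le> 0"
    using v by (simp add: power2_eq_square)
  then have "(transpose M ** M) *v v = s\<^sup>2 *\<^sub>R v"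
    by (simp add: matrix_vector_mul_assoc del: transpose_matrix_vector)
  moreover have "0 \<le> s" "v \<noteq> 0"
    using v by (auto simp: s_def)
  ultimately have "s \<in> singular_values M"
    by (auto simp: singular_values_def)
  then show thesis
    using bound that by blast
qed

text \<open>The maximum runs over a finite nonempty set, so it can be compared with 1 elementwise.
  One direction uses the singular value that bounds M everywhere, the other evaluates M at an
  eigenvector of M^T M.\<close>

lemma spectral_norm_le_1_iff:
  fixes M :: "real ^ 'n ^ 'm"
  shows "spectral_norm M \<le> 1 \<longleftrightarrow> (\<forall>w. norm (M *v w) \<le> norm w)"
proof -
  obtain s where s: "s \<in> singular_values M" and bound: "\<And>w. norm (M *v w) \<le> s * norm w"
    using singular_value_norm_bound[of M] by auto
  have iff: "spectral_norm M \<le> 1 \<longleftrightarrow> (\<forall>t\<in>singular_values M. t \<le> 1)"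
    unfolding spectral_norm_def using finite_singular_values s by (intro Max_le_iff) auto
  show ?thesis
  proof
    assume "spectral_norm M \<le> 1"
    with iff s have "s \<le> 1" by blast
    show "\<forall>w. norm (M *v w) \<le> norm w"
    proof
      fix w :: "real ^ 'n"
      have "s * norm w \<le> 1 * norm w"
        using \<open>s \<le> 1\<close> by (rule mult_right_mono) simp
      with bound[of w] show "norm (M *v w) \<le> norm w" by simp
    qed
  next
    assume contr: "\<forall>w. norm (M *v w) \<le> norm w"
    have "t \<le> 1" if "t \<in> singular_values M" for t
    proof -
      from that obtain v where t: "0 \<le> t" and v: "v \<noteq> 0"
        and ev: "(transpose M ** M) *v v = t\<^sup>2 *\<^sub>R v"
        by (auto simp: singular_values_def)
      have "t\<^sup>2 * (norm v)\<^sup>2 = (norm (M *v v))\<^sup>2"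
        using inner_gram_matrix[of M v v] ev by (simp add: power2_norm_eq_inner)
      also have "\<dots> \<le> 1\<^sup>2 * (norm v)\<^sup>2"
        using contr by (simp add: power_mono)
      finally have "t\<^sup>2 \<le> 1\<^sup>2"
        using v by simp
      then show ?thesis
        by (rule power2_le_imp_le) simp
    qed
    with iff show "spectral_norm M \<le> 1" by blast
  qed
qed

lemma sum_UNIV_Plus:
  fixes f :: "'a::finite + 'b::finite \<Rightarrow> 'c::comm_monoid_add"
  shows "sum f UNIV = (\<Sum>a\<in>UNIV. f (Inl a)) + (\<Sum>b\<in>UNIV. f (Inr b))"
  using sum.Plus[of "UNIV :: 'a set" "UNIV :: 'b set" f] by simp

text \<open>The two off-diagonal blocks are transposes of each other and contribute equally, whence
  the factor 2.\<close>

lemma block_matrix_quadratic_form: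
  fixes M :: "real ^ 'b::finite ^ 'a::finite" and v :: "real ^ ('a + 'b)"
  defines "u \<equiv> \<chi> a. v $ Inl a" and "w \<equiv> \<chi> b. v $ Inr b"
  shows "v \<bullet> (block_matrix (mat 1) M (transpose M) (mat 1) *v v)
    = u \<bullet> u + 2 * (u \<bullet> (M *v w)) + w \<bullet> w"
proof -
  let ?B = "block_matrix (mat 1) M (transpose M) (mat 1)"
  \<comment> \<open>The product \<open>mat 1 *v u\<close> is kept unsimplified so that both sides
    unfold to the same sums.\<close>
  have l: "(?B *v v) $ Inl a = (mat 1 *v u + M *v w) $ a" for a
    by (simp add: matrix_vector_mult_def block_matrix_def sum_UNIV_Plus u_def w_def
        del: matrix_vector_mul_lid)
  have r: "(?B *v v) $ Inr b = (transpose M *v u + mat 1 *v w) $ b" for b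
    by (simp add: matrix_vector_mult_def block_matrix_def sum_UNIV_Plus u_def w_def
        del: matrix_vector_mul_lid)
  have "v \<bullet> (?B *v v) = u \<bullet> (u + M *v w) + w \<bullet> (transpose M *v u + w)"
    by (simp add: inner_vec_def sum_UNIV_Plus l r) (simp add: u_def w_def)
  moreover have "w \<bullet> (transpose M *v u) = u \<bullet> (M *v w)"
    by (metis inner_matrix_transpose inner_commute)
  ultimately show ?thesis
    by (simp add: inner_add_right del: transpose_matrix_vector)
qed

lemma symmetric_block_matrix:
  "transpose (block_matrix (mat 1) M (transpose M) (mat 1))
    = block_matrix (mat 1) M (transpose M) (mat 1)"
  by (auto simp: vec_eq_iff transpose_def block_matrix_def mat_def split: sum.splits)

text \<open>Schur complement of the identity block: completing the square turns the quadratic form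
  into the squared norm of u + M w plus the difference of the squared norms of w and M w.\<close>

lemma pos_semidef_block_matrix_iff:
  fixes M :: "real ^ 'b::finite ^ 'a::finite"
  shows "pos_semidef (block_matrix (mat 1) M (transpose M) (mat 1)) \<longleftrightarrow> spectral_norm M \<le> 1"
proof -
  let ?B = "block_matrix (mat 1) M (transpose M) (mat 1)"
  have "(\<forall>v. 0 \<le> v \<bullet> (?B *v v)) \<longleftrightarrow> (\<forall>w. norm (M *v w) \<le> norm w)"
  proof
    assume psd: "\<forall>v. 0 \<le> v \<bullet> (?B *v v)"
    show "\<forall>w. norm (M *v w) \<le> norm w"
    proof
      fix w :: "real ^ 'b"
      \<comment> \<open>For fixed w this choice makes the completed square vanish, leaving only the
        difference.\<close>
      let ?u = "- (M *v w)"
      let ?v = "\<chi> i. case i of Inl a \<Rightarrow> ?u $ a | Inr b \<Rightarrow> w $ b"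
      have "0 \<le> ?u \<bullet> ?u + 2 * (?u \<bullet> (M *v w)) + w \<bullet> w"
        using psd[rule_format, of ?v] unfolding block_matrix_quadratic_form
        by (simp add: vec_lambda_eta del: vector_uminus_component)
      then show "norm (M *v w) \<le> norm w"
        by (simp add: norm_le)
    qed
  next
    assume contr: "\<forall>w. norm (M *v w) \<le> norm w"
    show "\<forall>v. 0 \<le> v \<bullet> (?B *v v)"
    proof
      fix v :: "real ^ ('a + 'b)"
      define u where "u = (\<chi> a. v $ Inl a)"
      define w where "w = (\<chi> b. v $ Inr b)"
      have "0 \<le> (u + M *v w) \<bullet> (u + M *v w) + (w \<bullet> w - (M *v w) \<bullet> (M *v w))"
        using contr by (intro add_nonneg_nonneg) (auto simp: norm_le)
      then show "0 \<le> v \<bullet> (?B *v v)"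
        unfolding block_matrix_quadratic_form u_def[symmetric] w_def[symmetric]
        by (simp add: inner_add inner_commute)
    qed
  qed
  then show ?thesis
    by (simp add: pos_semidef_def symmetric_block_matrix spectral_norm_le_1_iff)
qed

theorem theorem5:
  fixes A :: "'d::finite \<Rightarrow> ('n1::finite, 'n2::finite, 'n3::finite) tensor"
    and b :: "real ^ 'd"
    and Ups :: "(real ^ 'n1) set"
    and lam :: "real ^ 'd"
    and Z :: "('n1, 'n2, 'n3) tensor"
    and xstar :: "real ^ 'n1"
  assumes "inj A" and "independent (range A)"
    and "{T. \<forall>l. A l \<bullet> T = b $ l} \<noteq> {}"
    and "finite Ups" and "Ups \<subseteq> sphere 0 1"
    and "dual_optimal A b Ups (lam, Z)"
    and "is_arg_max (\<lambda>x. spectral_norm (tensor_apply Z x)) (\<lambda>x. norm x = 1) xstar"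
    and "xstar \<in> Ups"
  shows "dual_optimal A b (sphere 0 1) (lam, Z)"
proof -
  have feasible_iff: "dual_feasible A X (mu, Y) \<longleftrightarrow>
      (\<forall>x\<in>X. spectral_norm (tensor_apply Y x) \<le> 1) \<and> Y = (\<Sum>l\<in>UNIV. (mu $ l) *\<^sub>R A l)" for X mu Y
    by (simp add: dual_feasible_def pos_semidef_block_matrix_iff)
  have feas: "dual_feasible A Ups (lam, Z)"
    and opt: "\<And>mu Y. dual_feasible A Ups (mu, Y) \<Longrightarrow> \<not> mu \<bullet> b > lam \<bullet> b"
    using assms(6) by (auto simp: dual_optimal_def is_arg_max_def)
  have "spectral_norm (tensor_apply Z x) \<le> 1" if "norm x = 1" for x
  proof -
    \<comment> \<open>Maximality of \<open>xstar\<close> reduces the bound on the whole sphere to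
      the single point \<open>xstar\<close>, where DUAL(D) imposes it.\<close>
    have "spectral_norm (tensor_apply Z x) \<le> spectral_norm (tensor_apply Z xstar)"
      using assms(7) that by (auto simp: is_arg_max_def not_less)
    also have "\<dots> \<le> 1"
      using feas \<open>xstar \<in> Ups\<close> unfolding feasible_iff by blast
    finally show ?thesis .
  qed
  then have "dual_feasible A (sphere 0 1) (lam, Z)"
    using feas unfolding feasible_iff by simp
  \<comment> \<open>DUAL imposes the constraint at more points, so each of its feasible pairs
    competes in DUAL(D) and cannot beat \<open>lam\<close>.\<close>
  moreover have "dual_feasible A Ups (mu, Y)" if "dual_feasible A (sphere 0 1) (mu, Y)" for mu Y
    using that \<open>Ups \<subseteq> sphere 0 1\<close> unfolding feasible_iff by blast
  ultimately show ?thesis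
    using opt by (auto simp: dual_optimal_def is_arg_max_def)
qed

end
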